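(* Let $K\ge 1$ and $n\ge1$. For $i=1,\dots,K$ let $\mathsf{V}_i\in\mathbb{R}^{n\times n}$ be symmetric positive semidefinite with $\mathrm{rank}(\mathsf{V}_i)=k_i$, and let $\mathbf{u}_i\in\mathbb{R}^n$ lie in the range of $\mathsf{V}_i$, so that $f^{\mathrm E}(\mathbf{x};\mathbf{u}_i,\mathsf{V}_i)$ are $K$ (possibly degenerate) Gaussian densities on $\mathbb{R}^n$. Then for all $\mathbf{x}\in\mathbb{R}^n$ $$\prod_{i=1}^K f^{\mathrm E}(\mathbf{x};\mathbf{u}_i,\mathsf{V}_i)=s\cdot f^{\mathrm E}(\mathbf{x};\mathbf{u},\mathsf{V}),\qquad \mathbf{u}=\sum_{i=1}^K\mathbf{u}_i,\quad \mathsf{V}=\sum_{i=1}^K\mathsf{V}_i,$$ where, with $k=\mathrm{rank}(\mathsf{V})$, $\alpha=-\tfrac12\mathbf{u}^{\mathrm T}\mathsf{V}^+\mathbf{u}$ and $\alpha_i=-\tfrac12\mathbf{u}_i^{\mathrm T}\mathsf{V}_i^+\mathbf{u}_i$, the scaling factor is $$s=\frac{\prod_{i=1}^K|\mathsf{V}_i|_+^{1/2}}{(2\pi)^{(\sum_{i=1}^K k_i-k)/2}\,|\mathsf{V}|_+^{1/2}}\exp\Big(-\alpha+\sum_{i=1}^K\alpha_i\Big).$$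
   Context: For a symmetric positive semidefinite matrix $\mathsf{V}\in\mathbb{R}^{n\times n}$ of rank $k$ and a vector $\mathbf{u}\in\mathbb{R}^n$ of the form $\mathbf{u}=\mathsf{V}\mathbf{m}$ for some $\mathbf m\in\mathbb{R}^n$, the (possibly degenerate) Gaussian density in the parameters $(\mathbf{u},\mathsf{V})$ is the function on all of $\mathbb{R}^n$ $$f^{\mathrm E}(\mathbf{x};\mathbf{u},\mathsf{V})=\frac{|\mathsf{V}|_+^{1/2}}{(2\pi)^{k/2}}\exp\!\Big(-\tfrac12\mathbf{x}^{\mathrm T}\mathsf{V}\mathbf{x}+\mathbf{x}^{\mathrm T}\mathbf{u}-\tfrac12\mathbf{u}^{\mathrm T}\mathsf{V}^{+}\mathbf{u}\Big).$$ Here $\mathsf{V}^+$ is the Moore–Penrose pseudo-inverse and $|\mathsf{V}|_+$ is the pseudo-determinant, i.e. the product of the positive eigenvalues of $\mathsf{V}$ counted with multiplicity (empty product $=1$). *)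

theory Defs
  imports "HOL-Analysis.Analysis" "HOL-Computational_Algebra.Polynomial"
begin

definition psd :: "real^'n^'n \<Rightarrow> bool" where
  "psd V \<longleftrightarrow> transpose V = V \<and> (\<forall>x. 0 \<le> x \<bullet> (V *v x))"

definition is_moore_penrose :: "real^'n^'m \<Rightarrow> real^'m^'n \<Rightarrow> bool" where
  "is_moore_penrose A B \<longleftrightarrow>
     A ** B ** A = A \<and> B ** A ** B = B \<and>
     transpose (A ** B) = A ** B \<and> transpose (B ** A) = B ** A"

definition pinv :: "real^'n^'m \<Rightarrow> real^'m^'n" where
  "pinv A = (THE B. is_moore_penrose A B)"

definition charpoly :: "real^'n^'n \<Rightarrow> real poly" where
  "charpoly A = det (mat [:0, 1:] - map_matrix (\<lambda>c. [:c:]) A)"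

text \<open>The multiset of roots \<^const>\<open>proots\<close> records the (algebraic) multiplicities of the eigenvalues.\<close>

definition pseudo_det :: "real^'n^'n \<Rightarrow> real" where
  "pseudo_det A = (\<Prod>l \<in># filter_mset (\<lambda>l. 0 < l) (proots (charpoly A)). l)"

text \<open>
  The two conditions under which \<open>gauss_density\<close> below is a (possibly degenerate) Gaussian
  density; as a function of the parameters it is total.
\<close>

definition gauss_params :: "real^'n \<Rightarrow> real^'n^'n \<Rightarrow> bool" where
  "gauss_params u V \<longleftrightarrow> psd V \<and> u \<in> range ((*v) V)"

definition gauss_density :: "real^'n \<Rightarrow> real^'n \<Rightarrow> real^'n^'n \<Rightarrow> real" where
  "gauss_density x u V =
     sqrt (pseudo_det V) / (2 * pi) powr (real (rank V) / 2) *
     exp (- 1/2 * (x \<bullet> (V *v x)) + x \<bullet> u - 1/2 * (u \<bullet> (pinv V *v u)))"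

lemma is_moore_penrose_unique:
  assumes "is_moore_penrose A B" "is_moore_penrose A C"
  shows "B = C"
proof -
  have AB: "A ** B = A ** C"
  proof -
    have "A ** B = transpose (A ** C ** A ** B)"
      using assms by (simp add: is_moore_penrose_def)
    also have "\<dots> = transpose ((A ** C) ** (A ** B))"
      by (simp add: matrix_mul_assoc)
    also have "\<dots> = (A ** B) ** (A ** C)"
      using assms by (simp add: is_moore_penrose_def matrix_transpose_mul)
    also have "\<dots> = A ** C"
      using assms by (simp add: is_moore_penrose_def matrix_mul_assoc)
    finally show ?thesis .
  qed
  have BA: "B ** A = C ** A"
  proof -
    have "B ** A = transpose (B ** (A ** C ** A))"
      using assms by (simp add: is_moore_penrose_def)
    also have "\<dots> = transpose ((B ** A) ** (C ** A))"
      by (simp add: matrix_mul_assoc)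
    also have "\<dots> = (C ** A) ** (B ** A)"
      using assms by (simp add: is_moore_penrose_def matrix_transpose_mul)
    also have "\<dots> = C ** (A ** B ** A)"
      by (simp add: matrix_mul_assoc)
    also have "\<dots> = C ** A"
      using assms by (simp add: is_moore_penrose_def)
    finally show ?thesis .
  qed
  have "B = B ** A ** B" using assms by (simp add: is_moore_penrose_def)
  also have "\<dots> = C ** (A ** B)" by (simp add: BA matrix_mul_assoc)
  also have "\<dots> = C ** A ** C" by (simp add: AB matrix_mul_assoc)
  also have "\<dots> = C" using assms by (simp add: is_moore_penrose_def)
  finally show ?thesis .
qed

lemma inner_transpose: "(transpose A *v y) \<bullet> x = y \<bullet> (A *v x)" for A :: "real^'n^'m"
  by (simp add: dot_lmul_matrix)

lemma symmetric_matrixI: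
  fixes S :: "real^'n^'n"
  assumes "\<And>x y. (S *v x) \<bullet> y = x \<bullet> (S *v y)"
  shows "transpose S = S"
proof -
  have "(transpose S *v x) \<bullet> y = (S *v x) \<bullet> y" for x y
    by (metis assms inner_transpose)
  then show ?thesis
    by (metis matrix_eq vector_eq_rdot)
qed

lemma normal_equation_solvable:
  fixes A :: "real^'n^'m"
  shows "\<exists>z. A *v (transpose A *v z) - y \<in> {q. transpose A *v q = 0}"
proof -
  have ort: "\<exists>p q. x = M *v p + q \<and> transpose M *v q = 0"
    for M :: "real^'a^'b" and x :: "real^'b"
  proof -
    have sub: "subspace (range ((*v) M))"
      by (simp add: linear_subspace_image)
    obtain a q where aq: "a \<in> span (range ((*v) M))"
      "\<And>w. w \<in> span (range ((*v) M)) \<Longrightarrow> orthogonal q w" "x = a + q"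
      using orthogonal_subspace_decomp_exists[of "range ((*v) M)" x] by metis
    then obtain p where "a = M *v p"
      using sub by (metis imageE span_eq_iff)
    moreover have "transpose M *v q = 0"
    proof -
      have "(transpose M *v q) \<bullet> w = 0" for w
        using aq(2)[of "M *v w"] by (simp add: dot_lmul_matrix orthogonal_def span_base)
      then show ?thesis by (metis inner_eq_zero_iff)
    qed
    ultimately show ?thesis using aq(3) by auto
  qed
  obtain p q where pq: "y = A *v p + q" "transpose A *v q = 0"
    using ort[of y A] by blast
  obtain z s where zs: "p = transpose A *v z + s" "A *v s = 0"
    using ort[of p "transpose A"] by auto
  have "A *v (transpose A *v z) - y = - q"
    using pq zs by (simp add: matrix_vector_right_distrib)
  then show ?thesis using pq(2) by (metis (mono_tags, lifting) linear_neg matrix_vector_mul_linear mem_Collect_eq neg_equal_0_iff_equal)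
qed

lemma is_moore_penrose_exists:
  fixes A :: "real^'n^'m"
  shows "\<exists>B. is_moore_penrose A B"
proof -
  define T where "T = transpose A"
  have dl: "(T *v y) \<bullet> x = y \<bullet> (A *v x)" for x y
    unfolding T_def by (rule inner_transpose)
  have diff: "M *v (x - y) = M *v x - M *v y" for M :: "real^'a^'b" and x y
    by (simp add: matrix_vector_mult_diff_distrib)
  have k: "A *v x = 0" if "T *v (A *v x) = 0" for x
    using that dl[of "A *v x" x] by simp
  have uniq: "x = x'"
    if xx: "x \<in> range ((*v) T)" "x' \<in> range ((*v) T)" "T *v (A *v x) = T *v (A *v x')" for x x'
  proof -
    obtain w where w: "x - x' = T *v w"
      using xx(1,2) by (auto simp flip: diff)
    have "A *v (x - x') = 0"
      using xx(3) by (intro k) (simp add: diff)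
    then have "(T *v w) \<bullet> (T *v w) = 0"
      by (metis dl inner_zero_right w)
    then show ?thesis using w by simp
  qed
  have "\<exists>x. x \<in> range ((*v) T) \<and> T *v (A *v x) = T *v y" for y
    using normal_equation_solvable[of A y] by (auto simp: diff simp flip: T_def)
  then obtain b where b: "\<And>y. b y \<in> range ((*v) T)" "\<And>y. T *v (A *v b y) = T *v y"
    by metis
  have "linear b"
  proof (rule linearI)
    have sub: "subspace (range ((*v) T))"
      by (simp add: linear_subspace_image)
    show "b (x + y) = b x + b y" for x y
      by (rule uniq) (simp_all only: b matrix_vector_right_distrib subspace_add[OF sub])
    show "b (c *\<^sub>R x) = c *\<^sub>R b x" for c x
      by (rule uniq) (simp_all only: b matrix_vector_mult_scaleR subspace_mul[OF sub])
  qed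
  define B where "B = matrix b"
  have B: "B *v y = b y" for y
    using \<open>linear b\<close> by (simp add: B_def matrix_works)
  have aba: "A *v b (A *v x) = A *v x" for x
    using k[of "b (A *v x) - x"] b(2)[of "A *v x"] by (simp add: diff)
  have bab: "b (A *v b y) = b y" for y
    by (rule uniq) (simp_all only: b)
  have ab: "(A *v w) \<bullet> (A *v b y) = (A *v w) \<bullet> y" for w y
    by (metis b(2) dl inner_commute)
  have ba: "b y \<bullet> b (A *v w) = b y \<bullet> w" for w y
  proof -
    obtain v where "b y = T *v v" using b(1) by blast
    then show ?thesis by (simp add: dl aba)
  qed
  have "A ** B ** A = A" "B ** A ** B = B"
    by (simp_all add: matrix_eq B aba bab flip: matrix_vector_mul_assoc)
  moreover have "transpose (A ** B) = A ** B"
    by (rule symmetric_matrixI) (metis B ab inner_commute matrix_vector_mul_assoc)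
  moreover have "transpose (B ** A) = B ** A"
    by (rule symmetric_matrixI) (metis B ba inner_commute matrix_vector_mul_assoc)
  ultimately show ?thesis
    unfolding is_moore_penrose_def by blast
qed

lemma pinv_is_moore_penrose: "is_moore_penrose A (pinv A)"
  unfolding pinv_def by (metis is_moore_penrose_exists is_moore_penrose_unique theI)

lemma poly_charpoly: "poly (charpoly A) l = det (mat l - A)"
proof -
  have "poly (if i = j then [:0, 1:] else 0) l = (if i = j then l else 0)" for i j :: 'a
    by simp
  then show ?thesis
    by (simp add: charpoly_def det_def poly_sum poly_prod mat_def)
qed

lemma poly_charpoly_eq_0_iff:
  "poly (charpoly A) l = 0 \<longleftrightarrow> (\<exists>x. x \<noteq> 0 \<and> A *v x = l *\<^sub>R x)"
proof -
  have m: "mat l *v x = l *\<^sub>R x" for x :: "real^'a"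
    by (simp add: vec_eq_iff matrix_vector_mult_def mat_def if_distrib if_distribR cong: if_cong)
  have "poly (charpoly A) l = 0 \<longleftrightarrow> (\<exists>x. x \<noteq> 0 \<and> (mat l - A) *v x = 0)"
    by (metis poly_charpoly invertible_det_nz invertible_left_inverse matrix_left_invertible_ker
        matrix_vector_mult_0_right)
  then show ?thesis
    by (auto simp: matrix_vector_mult_diff_rdistrib m)
qed

lemma charpoly_nonzero: "charpoly A \<noteq> 0"
proof
  assume "charpoly A = 0"
  define l where "l = onorm ((*v) A) + 1"
  obtain x where x: "x \<noteq> 0" "A *v x = l *\<^sub>R x"
    using poly_charpoly_eq_0_iff[of A l] \<open>charpoly A = 0\<close> by auto
  have "0 \<le> onorm ((*v) A)"
    by (simp add: onorm_pos_le linear_linear)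
  moreover have "norm (A *v x) \<le> onorm ((*v) A) * norm x"
    by (simp add: onorm linear_linear)
  ultimately show False
    using x by (simp add: l_def)
qed

lemma positive_eigenvalues_mset:
  "set_mset (filter_mset (\<lambda>l. 0 < l) (proots (charpoly A))) =
     {l. 0 < l \<and> (\<exists>x. x \<noteq> 0 \<and> A *v x = l *\<^sub>R x)}"
  by (auto simp: charpoly_nonzero poly_charpoly_eq_0_iff)

end

theory Submission
  imports Defs
begin

text \<open>
  Taking products adds the exponents, so the only point is that the sum of the parameters is
  again admissible. A positive semidefinite form vanishes only on the kernel of its matrix, so
  the kernel of \<open>W = V\<^sub>1 + \<dots> + V\<^sub>K\<close> is contained in the kernel of each \<open>V\<^sub>i\<close>. Taking orthogonal
  complements, the range of \<open>W\<close> contains the range of each \<open>V\<^sub>i\<close>, and with it the sum of the \<open>u\<^sub>i\<close>.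
\<close>

lemma sum_matrix_vector_mult:
  fixes V :: "'a \<Rightarrow> real^'n^'m"
  shows "(\<Sum>i\<in>I. V i) *v x = (\<Sum>i\<in>I. V i *v x)"
  by (induction I rule: infinite_finite_induct) (simp_all add: matrix_vector_mult_add_rdistrib)

lemma psd_symmetric: "psd V \<Longrightarrow> (V *v x) \<bullet> y = x \<bullet> (V *v y)"
  by (metis psd_def inner_transpose)

lemma psd_sum:
  assumes "\<And>i. i \<in> I \<Longrightarrow> psd (V i)"
  shows "psd (\<Sum>i\<in>I. V i)"
  unfolding psd_def
proof
  show "transpose (\<Sum>i\<in>I. V i) = (\<Sum>i\<in>I. V i)"
    using assms
    by (intro symmetric_matrixI)
       (auto simp: sum_matrix_vector_mult inner_sum_left inner_sum_right psd_symmetric intro!: sum.cong)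
  show "\<forall>x. 0 \<le> x \<bullet> ((\<Sum>i\<in>I. V i) *v x)"
    using assms by (auto simp: sum_matrix_vector_mult inner_sum_right psd_def intro!: sum_nonneg)
qed

text \<open>A zero of a nonnegative form is a minimum, so moving from \<open>q\<close> along
  \<open>V *v q\<close> cannot lower the value; a small step against that direction would do so
  unless \<open>V *v q = 0\<close>.\<close>

lemma psd_quadratic_form_eq_0_iff:
  assumes "psd V"
  shows "q \<bullet> (V *v q) = 0 \<longleftrightarrow> V *v q = 0"
proof
  assume q: "q \<bullet> (V *v q) = 0"
  define w where "w = V *v q"
  define c where "c = w \<bullet> (V *v w)"
  \<comment> \<open>The form at \<open>q + t *\<^sub>R w\<close> equals
    \<open>2 * t * (w \<bullet> w) + t * t * c\<close>, with minimiser
    \<open>- (w \<bullet> w) / c\<close> when \<open>c > 0\<close>. The denominator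
    \<open>c + 1\<close> also covers \<open>c = 0\<close> and still gives a negative value unless
    \<open>w = 0\<close>.\<close>
  define t where "t = - (w \<bullet> w) / (c + 1)"
  have c: "0 \<le> c"
    using assms by (simp add: c_def psd_def)
  have "0 \<le> (q + t *\<^sub>R w) \<bullet> (V *v (q + t *\<^sub>R w))"
    using assms by (simp add: psd_def)
  also have "\<dots> = q \<bullet> (V *v q) + t * (w \<bullet> (V *v q)) + t * (q \<bullet> (V *v w)) + t * t * (w \<bullet> (V *v w))"
    by (simp add: matrix_vector_right_distrib matrix_vector_mult_scaleR inner_add_left
        inner_add_right algebra_simps)
  also have "q \<bullet> (V *v w) = w \<bullet> w"
    using psd_symmetric[OF assms, of q w] by (simp add: w_def)
  also have "q \<bullet> (V *v q) + t * (w \<bullet> (V *v q)) + t * (w \<bullet> w) + t * t * (w \<bullet> (V *v w))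
      = - (w \<bullet> w)\<^sup>2 * (c + 2) / (c + 1)\<^sup>2"
    using c q by (simp add: t_def divide_simps power2_eq_square flip: c_def w_def)
      (simp add: algebra_simps)
  finally have "(w \<bullet> w)\<^sup>2 * (c + 2) / (c + 1)\<^sup>2 \<le> 0"
    by simp
  then have "(w \<bullet> w)\<^sup>2 \<le> 0"
    using c by (auto simp: divide_le_0_iff mult_le_0_iff)
  then show "V *v q = 0"
    by (simp add: w_def)
qed simp

lemma range_psd_sum:
  assumes "finite I" "\<And>i. i \<in> I \<Longrightarrow> psd (V i)" "j \<in> I"
  shows "range ((*v) (V j)) \<subseteq> range ((*v) (\<Sum>i\<in>I. V i))"
proof (clarify)
  fix m
  define W where "W = (\<Sum>i\<in>I. V i)"
  have W: "psd W"
    using assms(2) unfolding W_def by (rule psd_sum)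
  \<comment> \<open>Least squares replaces the orthogonal complements: as \<open>W\<close> is
    symmetric, the normal equation leaves a residual \<open>q\<close> in the kernel of
    \<open>W\<close>. The goal is \<open>q = 0\<close>.\<close>
  obtain z q where z: "V j *v m = W *v z - q" and q: "W *v q = 0"
  proof -
    have "transpose W = W"
      using W by (simp add: psd_def)
    then obtain z where "W *v (W *v (W *v z) - V j *v m) = 0"
      using normal_equation_solvable[of W "V j *v m"] by (simp only: mem_Collect_eq) blast
    then show thesis
      by (intro that[of "W *v z" "W *v (W *v z) - V j *v m"]) simp_all
  qed
  \<comment> \<open>The sum is \<open>q \<bullet> (W *v q)\<close>, and its terms are nonnegative,
    so each of them vanishes.\<close>
  have "(\<Sum>i\<in>I. q \<bullet> (V i *v q)) = 0"
    using q by (simp add: W_def sum_matrix_vector_mult flip: inner_sum_right)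
  then have "q \<bullet> (V j *v q) = 0"
    using assms by (subst (asm) sum_nonneg_eq_0_iff) (auto simp: psd_def)
  then have "V j *v q = 0"
    using assms by (simp add: psd_quadratic_form_eq_0_iff)
  then have "q \<bullet> (V j *v m) = 0"
    using psd_symmetric[of "V j" q m] assms by simp
  moreover have "q \<bullet> (W *v z) = 0"
    using psd_symmetric[OF W, of q z] q by simp
  \<comment> \<open>\<open>q\<close> is orthogonal to both \<open>W *v z\<close> and
    \<open>V j *v m\<close>, hence to their difference, which is \<open>q\<close> itself.\<close>
  ultimately have "q \<bullet> q = 0"
    by (simp add: z inner_diff_right)
  with z show "V j *v m \<in> range ((*v) W)"
    by simp
qed

lemma gauss_params_sum:
  assumes "finite I" "\<And>i. i \<in> I \<Longrightarrow> gauss_params (u i) (V i)"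
  shows "gauss_params (\<Sum>i\<in>I. u i) (\<Sum>i\<in>I. V i)"
proof -
  have "(\<Sum>i\<in>I. u i) \<in> range ((*v) (\<Sum>i\<in>I. V i))"
  proof (rule subspace_sum)
    show "subspace (range ((*v) (\<Sum>i\<in>I. V i)))"
      by (simp add: linear_subspace_image)
    show "u i \<in> range ((*v) (\<Sum>i\<in>I. V i))" if "i \<in> I" for i
      using range_psd_sum[of I V i] assms that unfolding gauss_params_def by blast
  qed
  then show ?thesis
    using assms(2) psd_sum[of I V] by (simp add: gauss_params_def)
qed

text \<open>This allows the square root of the pseudo-determinant of \<open>W\<close> to be
  cancelled in the product formula.\<close>

lemma pseudo_det_pos: "0 < pseudo_det A"
proof -
  have "0 < \<Prod>\<^sub># M" if "\<forall>l\<in>#M. 0 < l" for M :: "real multiset"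
    using that by (induction M) auto
  then show ?thesis
    by (simp add: pseudo_det_def)
qed

lemma gauss_density_prod:
  fixes u :: "'a \<Rightarrow> real^'n" and V :: "'a \<Rightarrow> real^'n^'n"
  assumes "finite I"
  defines "U \<equiv> \<Sum>i\<in>I. u i" and "W \<equiv> \<Sum>i\<in>I. V i"
  shows "(\<Prod>i\<in>I. gauss_density x (u i) (V i)) =
    (\<Prod>i\<in>I. sqrt (pseudo_det (V i))) /
    ((2 * pi) powr (((\<Sum>i\<in>I. real (rank (V i))) - real (rank W)) / 2) * sqrt (pseudo_det W)) *
    exp (1/2 * (U \<bullet> (pinv W *v U)) + (\<Sum>i\<in>I. - 1/2 * (u i \<bullet> (pinv (V i) *v u i)))) *
    gauss_density x U W"
proof -
  \<comment> \<open>Here \<open>p\<close> and \<open>r\<close> are the powers of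
    \<open>2 * pi\<close> for the rank difference and for the rank of \<open>W\<close>, while
    \<open>d = sqrt (pseudo_det W)\<close> is inserted above and below. The last factor is then the
    density for \<open>U\<close> and \<open>W\<close>.\<close>
  have regroup: "P / (p * r) * exp (b + c) = P / (p * d) * exp b * (d / r * exp c)"
    if "0 < d" for P p r b c d :: real
    using that by (simp add: exp_add)
  let ?p = "\<lambda>t. (2 * pi) powr (t / 2)"
  define e where "e i = - 1/2 * (x \<bullet> (V i *v x)) + x \<bullet> u i - 1/2 * (u i \<bullet> (pinv (V i) *v u i))" for i
  define R where "R = (\<Sum>i\<in>I. real (rank (V i)))"
  define a where "a = (\<Sum>i\<in>I. - 1/2 * (u i \<bullet> (pinv (V i) *v u i)))"
  have "(\<Prod>i\<in>I. gauss_density x (u i) (V i)) =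
      (\<Prod>i\<in>I. sqrt (pseudo_det (V i))) / (\<Prod>i\<in>I. ?p (real (rank (V i)))) * (\<Prod>i\<in>I. exp (e i))"
    by (simp add: gauss_density_def e_def prod.distrib prod_dividef)
  also have "(\<Prod>i\<in>I. ?p (real (rank (V i)))) = ?p R"
    by (simp add: R_def powr_sum sum_divide_distrib)
  also have "?p R = ?p (R - real (rank W)) * ?p (real (rank W))"
    by (simp add: diff_divide_distrib flip: powr_add)
  also have "(\<Prod>i\<in>I. exp (e i)) = exp (\<Sum>i\<in>I. e i)"
    using assms(1) by (simp add: exp_sum)
  \<comment> \<open>The constant term belonging to \<open>W\<close> is added and subtracted to
    complete the exponent of the density for \<open>U\<close> and \<open>W\<close>.\<close>
  also have "(\<Sum>i\<in>I. e i) = (1/2 * (U \<bullet> (pinv W *v U)) + a) +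
      (- 1/2 * (x \<bullet> (W *v x)) + x \<bullet> U - 1/2 * (U \<bullet> (pinv W *v U)))"
    by (simp add: e_def a_def U_def W_def sum_matrix_vector_mult inner_sum_right sum.distrib
        sum_subtractf sum_negf sum_divide_distrib)
  finally show ?thesis
    unfolding gauss_density_def[of x U W] R_def[symmetric] a_def[symmetric]
    by (rule trans) (rule regroup, simp add: pseudo_det_pos)
qed

text \<open>Since \<open>gauss_density\<close> is total, the conjunct
  \<open>gauss_params U W\<close> is what certifies that the right-hand side is a multiple of a
  genuine Gaussian density.\<close>

theorem lemma3:
  fixes K :: nat and V :: "nat \<Rightarrow> real^'n^'n" and u :: "nat \<Rightarrow> real^'n" and k :: "nat \<Rightarrow> nat"
  assumes "1 \<le> K"
    and "\<And>i. i \<in> {1..K} \<Longrightarrow> psd (V i)"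
    and "\<And>i. i \<in> {1..K} \<Longrightarrow> rank (V i) = k i"
    and "\<And>i. i \<in> {1..K} \<Longrightarrow> u i \<in> range ((*v) (V i))"
  shows "let U = (\<Sum>i=1..K. u i);
             W = (\<Sum>i=1..K. V i);
             r = rank W;
             \<alpha> = - 1/2 * (U \<bullet> (pinv W *v U));
             a = (\<lambda>i. - 1/2 * (u i \<bullet> (pinv (V i) *v u i)));
             s = (\<Prod>i=1..K. sqrt (pseudo_det (V i))) /
                 ((2 * pi) powr (((\<Sum>i=1..K. real (k i)) - real r) / 2) * sqrt (pseudo_det W)) *
                 exp (- \<alpha> + (\<Sum>i=1..K. a i))
         in gauss_params U W \<and>
            (\<forall>x. (\<Prod>i=1..K. gauss_density x (u i) (V i)) = s * gauss_density x U W)"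
proof -
  have "gauss_params (\<Sum>i=1..K. u i) (\<Sum>i=1..K. V i)"
    using assms by (intro gauss_params_sum) (auto simp: gauss_params_def)
  moreover have "(\<Sum>i=1..K. real (k i)) = (\<Sum>i=1..K. real (rank (V i)))"
    using assms(3) by simp
  ultimately show ?thesis
    by (simp only: Let_def gauss_density_prod[OF finite_atLeastAtMost]) simp
qed

end
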